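(* Let $X$ be a Banach space over the scalar field $\mathbb{K}$. Then $X$ is uniformly smooth if and only if the pair $(X,\mathbb{K})$ has the Bishop-Phelps-Bollobás point property.
   Context: $\mathbb{K}$ denotes $\mathbb{R}$ or $\mathbb{C}$. $S_X$ and $B_X$ are the unit sphere and closed unit ball of $X$, and $\mathcal{L}(X,Y)$ is the space of bounded linear operators from $X$ into $Y$ (so $\mathcal{L}(X,\mathbb{K})=X^*$). A Banach space $X$ is uniformly smooth if the limit $\lim_{t\to 0}\frac{\|z+tx\|-1}{t}$ exists uniformly for all $x\in B_X$ and $z\in S_X$. A pair $(X,Y)$ of Banach spaces over $\mathbb{K}$ has the Bishop-Phelps-Bollobás point property (BPBpp) if for every $\varepsilon>0$ there exists $\eta(\varepsilon)>0$ such that whenever $T\in\mathcal{L}(X,Y)$ with $\|T\|=1$ and $x\in S_X$ satisfy $\|T(x)\|>1-\eta(\varepsilon)$, there exists $S\in\mathcal{L}(X,Y)$ with $\|S\|=1$ such that $\|S(x)\|=1$ and $\|S-T\|<\varepsilon$. *)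

theory Defs
  imports "HOL-Analysis.Analysis"
begin

text \<open>
  A Banach space over a scalar field \<open>'k\<close> is a type of class \<^class>\<open>banach\<close> together with a scalar
  multiplication by \<open>'k\<close> that extends the real one and is compatible with the norm.
  For \<open>'k = real\<close> the only such multiplication is \<^const>\<open>scaleR\<close>.
\<close>

locale banach_space_over = vector_space scale
  for scale :: "'k::real_normed_field \<Rightarrow> 'a::banach \<Rightarrow> 'a" +
  assumes scale_of_real: "scale (of_real r) x = r *\<^sub>R x"
    and norm_scale: "norm (scale c x) = norm c * norm x"

lemma banach_space_over_scaleR: "banach_space_over (scaleR :: real \<Rightarrow> 'a::banach \<Rightarrow> 'a)"
  by unfold_locales (simp_all add: algebra_simps)

lemma banach_space_over_complex: "banach_space_over ((*) :: complex \<Rightarrow> complex \<Rightarrow> complex)"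
  by unfold_locales (simp_all add: algebra_simps norm_mult scaleR_conv_of_real)

text \<open>
  The type of bounded real-linear maps carries the operator norm; requiring linearity with respect
  to the given scalar multiplications selects the operators that are linear over \<open>'k\<close>.
\<close>

definition bounded_ops ::
  "('k::real_normed_field \<Rightarrow> 'a::banach \<Rightarrow> 'a) \<Rightarrow> ('k \<Rightarrow> 'b::banach \<Rightarrow> 'b) \<Rightarrow> ('a \<Rightarrow>\<^sub>L 'b) set"
  where "bounded_ops sX sY = {T. Vector_Spaces.linear sX sY (blinfun_apply T)}"

text \<open>The increment \<open>t\<close> is real for complex scalars as well.\<close>

definition uniformly_smooth :: "'a::banach itself \<Rightarrow> bool"
  where "uniformly_smooth _ \<longleftrightarrow>
    (\<exists>D. uniform_limit (sphere (0::'a) 1 \<times> cball (0::'a) 1)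
           (\<lambda>t (z, x). (norm (z + t *\<^sub>R x) - 1) / t) D (at (0::real)))"

definition BPBpp ::
  "('k::real_normed_field \<Rightarrow> 'a::banach \<Rightarrow> 'a) \<Rightarrow> ('k \<Rightarrow> 'b::banach \<Rightarrow> 'b) \<Rightarrow> bool"
  where "BPBpp sX sY \<longleftrightarrow>
    (\<forall>\<epsilon>>0. \<exists>\<eta>>0. \<forall>T\<in>bounded_ops sX sY. \<forall>x\<in>sphere 0 1.
       norm T = 1 \<longrightarrow> norm (blinfun_apply T x) > 1 - \<eta> \<longrightarrow>
       (\<exists>S\<in>bounded_ops sX sY. norm S = 1 \<and> norm (blinfun_apply S x) = 1 \<and> norm (S - T) < \<epsilon>))"

end

theory Submission
  imports Defs
begin

text \<open>
  Both implications compare a functional that almost norms a unit vector with one that norms it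
  exactly; the Hahn-Banach theorem supplies the latter.

  If the space is uniformly smooth, let \<open>F\<close> have norm one with \<open>F x\<close> close to \<open>1\<close>, and let \<open>G\<close> be a
  functional of norm one with \<open>G x = 1\<close>. Adding the real parts of \<open>G (x + t y)\<close> and \<open>F (x - t y)\<close>
  bounds \<open>t Re (G - F) y\<close> by \<open>norm (x + t y) + norm (x - t y) - 2\<close> plus the defect \<open>1 - Re F x\<close>.
  Uniform smoothness makes the first part at most a small multiple of \<open>t\<close>, for one \<open>t\<close> that serves
  all unit vectors \<open>x\<close> and \<open>y\<close>; a defect of the same size then forces \<open>G - F\<close> to be small
  (\<open>norm_diff_functionals_le\<close>). A functional with \<open>norm (T x)\<close> close to \<open>1\<close> is first multiplied by a
  unimodular scalar.

  Conversely, choose for every unit vector \<open>z\<close> a functional \<open>f\<close> of norm one with \<open>f z = 1\<close>. For small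
  \<open>t\<close>, \<open>f\<close> almost norms the unit vector \<open>w\<close> in the direction of \<open>z + t x\<close>, so the point property
  yields a functional \<open>S\<close> near \<open>f\<close> that norms \<open>w\<close>, and \<open>S w\<close> can be rotated to \<open>1\<close> at a small cost.
  The difference quotient of the norm lies between \<open>Re f x\<close> and \<open>Re S x\<close>
  (\<open>difference_quotient_close\<close>), hence converges to \<open>Re f x\<close> uniformly.

  Real and complex scalars are treated together, in a locale whose parameter \<open>re\<close> is the identity
  or the real part.
\<close>

section \<open>Sublinear functionals\<close>

text \<open>
  For positive homogeneity an inequality is enough, since rescaling by the inverse gives the other
  one; this suits functionals that are constructed as infima.
\<close>

definition sublinear :: "('a::real_vector \<Rightarrow> real) \<Rightarrow> bool"
  where "sublinear p \<longleftrightarrow>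
    (\<forall>x y. p (x + y) \<le> p x + p y) \<and> (\<forall>c\<ge>0. \<forall>x. p (c *\<^sub>R x) \<le> c * p x)"

lemma sublinear_add: "sublinear p \<Longrightarrow> p (x + y) \<le> p x + p y"
  by (simp add: sublinear_def)

lemma sublinear_zero:
  assumes "sublinear p"
  shows "p 0 = 0"
proof -
  have "p (0 *\<^sub>R 0) \<le> 0 * p 0"
    using assms unfolding sublinear_def by blast
  moreover have "p (0 + 0) \<le> p 0 + p 0"
    using assms by (rule sublinear_add)
  ultimately show ?thesis
    by simp
qed

lemma sublinear_scaleR:
  assumes "sublinear p" "0 \<le> c"
  shows "p (c *\<^sub>R x) = c * p x"
proof (cases "c = 0")
  case True
  then show ?thesis
    using sublinear_zero[OF assms(1)] by simp
next
  case False
  have le: "p (d *\<^sub>R y) \<le> d * p y" if "0 \<le> d" for d y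
    using assms(1) that unfolding sublinear_def by blast
  have "p (inverse c *\<^sub>R (c *\<^sub>R x)) \<le> inverse c * p (c *\<^sub>R x)"
    using assms(2) by (intro le) simp
  then have "c * p x \<le> p (c *\<^sub>R x)"
    using False assms(2) by (simp add: field_simps)
  with le[OF assms(2)] show ?thesis
    by (metis order_antisym)
qed

lemma sublinear_minus: "sublinear p \<Longrightarrow> - p (- x) \<le> p x"
  using sublinear_add[of p x "- x"] sublinear_zero[of p] by simp

lemma sublinear_norm: "sublinear (norm :: 'a::real_normed_vector \<Rightarrow> real)"
  by (simp add: sublinear_def norm_triangle_ineq)

text \<open>
  The largest sublinear functional below \<open>p\<close> whose value at \<open>- x\<close> is at most \<open>- p x\<close>, that is, which
  is linear with value \<open>p x\<close> in the direction \<open>x\<close>.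
\<close>

definition tighten :: "('a::real_vector \<Rightarrow> real) \<Rightarrow> 'a \<Rightarrow> 'a \<Rightarrow> real"
  where "tighten p x y = (INF t\<in>{0..}. p (y + t *\<^sub>R x) - t * p x)"

lemma tighten_lower_bound:
  assumes "sublinear p" "0 \<le> t"
  shows "- p (- y) \<le> p (y + t *\<^sub>R x) - t * p x"
proof -
  have "p ((y + t *\<^sub>R x) + - y) \<le> p (y + t *\<^sub>R x) + p (- y)"
    using assms(1) by (rule sublinear_add)
  then show ?thesis
    using sublinear_scaleR[OF assms] by simp
qed

lemma tighten_le:
  assumes "sublinear p" "0 \<le> t"
  shows "tighten p x y \<le> p (y + t *\<^sub>R x) - t * p x"
  unfolding tighten_def
proof (rule cINF_lower)
  show "bdd_below ((\<lambda>t. p (y + t *\<^sub>R x) - t * p x) ` {0..})"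
    using tighten_lower_bound[OF assms(1)] by (auto intro!: bdd_belowI2)
qed (use assms(2) in simp)

lemma tighten_greatest:
  assumes "\<And>t. 0 \<le> t \<Longrightarrow> b \<le> p (y + t *\<^sub>R x) - t * p x"
  shows "b \<le> tighten p x y"
  unfolding tighten_def by (rule cINF_greatest) (use assms in auto)

lemma sublinear_tighten:
  assumes p: "sublinear p"
  shows "sublinear (tighten p x)"
  unfolding sublinear_def
proof (intro conjI allI impI)
  fix y z
  have "tighten p x (y + z) - (p (z + t *\<^sub>R x) - t * p x) \<le> p (y + s *\<^sub>R x) - s * p x"
    if "0 \<le> s" "0 \<le> t" for s t
  proof -
    have "tighten p x (y + z) \<le> p ((y + z) + (s + t) *\<^sub>R x) - (s + t) * p x"
      using that by (intro tighten_le p) simp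
    also have "(y + z) + (s + t) *\<^sub>R x = (y + s *\<^sub>R x) + (z + t *\<^sub>R x)"
      by (simp add: algebra_simps)
    finally show ?thesis
      using sublinear_add[OF p, of "y + s *\<^sub>R x" "z + t *\<^sub>R x"] by (simp add: algebra_simps)
  qed
  then have "tighten p x (y + z) - (p (z + t *\<^sub>R x) - t * p x) \<le> tighten p x y" if "0 \<le> t" for t
    using that by (intro tighten_greatest)
  then have "tighten p x (y + z) - tighten p x y \<le> tighten p x z"
    by (intro tighten_greatest) (simp add: algebra_simps)
  then show "tighten p x (y + z) \<le> tighten p x y + tighten p x z"
    by simp
next
  fix c :: real and y
  assume "0 \<le> c"
  show "tighten p x (c *\<^sub>R y) \<le> c * tighten p x y"
  proof (cases "c = 0")
    case True
    have "tighten p x 0 \<le> p (0 + 0 *\<^sub>R x) - 0 * p x"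
      by (rule tighten_le[OF p]) simp
    with True show ?thesis
      by (simp add: sublinear_zero[OF p])
  next
    case False
    with \<open>0 \<le> c\<close> have c: "0 < c"
      by simp
    have "tighten p x (c *\<^sub>R y) / c \<le> p (y + t *\<^sub>R x) - t * p x" if "0 \<le> t" for t
    proof -
      have "tighten p x (c *\<^sub>R y) \<le> p (c *\<^sub>R y + (c * t) *\<^sub>R x) - (c * t) * p x"
        using that c by (intro tighten_le p) simp
      also have "c *\<^sub>R y + (c * t) *\<^sub>R x = c *\<^sub>R (y + t *\<^sub>R x)"
        by (simp add: algebra_simps)
      also have "p \<dots> = c * p (y + t *\<^sub>R x)"
        using c by (intro sublinear_scaleR p) simp
      finally show ?thesis
        using c by (simp add: field_simps)
    qed
    then have "tighten p x (c *\<^sub>R y) / c \<le> tighten p x y"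
      by (rule tighten_greatest)
    then show ?thesis
      using c by (simp add: field_simps)
  qed
qed

lemma tighten_self: "sublinear p \<Longrightarrow> tighten p x y \<le> p y"
  using tighten_le[of p 0 x y] by simp

lemma tighten_minus: "sublinear p \<Longrightarrow> tighten p x (- x) \<le> - p x"
  using tighten_le[of p 1 x "- x"] by (simp add: sublinear_zero)

lemma sublinear_INF_chain:
  fixes p :: "'a::real_vector \<Rightarrow> real"
  assumes C: "C \<noteq> {}" "\<And>q. q \<in> C \<Longrightarrow> sublinear q \<and> q \<le> p"
    and chain: "\<And>q r. q \<in> C \<Longrightarrow> r \<in> C \<Longrightarrow> q \<le> r \<or> r \<le> q"
  shows "sublinear (\<lambda>x. INF q\<in>C. q x)" "\<And>q x. q \<in> C \<Longrightarrow> (INF q\<in>C. q x) \<le> q x"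
proof -
  have "- p (- x) \<le> q x" if "q \<in> C" for q x
    using C(2)[OF that] sublinear_minus[of q x] le_funD[of q p "- x"] by linarith
  then show lower: "(INF q\<in>C. q x) \<le> q x" if "q \<in> C" for q x
    using that by (intro cINF_lower bdd_belowI2)
  show "sublinear (\<lambda>x. INF q\<in>C. q x)"
    unfolding sublinear_def
  proof (intro conjI allI impI)
    fix x y
    have "(INF q\<in>C. q (x + y)) \<le> q x + r y" if "q \<in> C" "r \<in> C" for q r
    proof -
      \<comment> \<open>The smaller of two members of the chain bounds the infimum at every point.\<close>
      obtain s where s: "s \<in> C" "s \<le> q" "s \<le> r"
        using chain[of q r] \<open>q \<in> C\<close> \<open>r \<in> C\<close> by (meson order_refl)
      have "(INF q\<in>C. q (x + y)) \<le> s (x + y)"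
        using s(1) by (rule lower)
      also have "\<dots> \<le> s x + s y"
        using C(2)[OF s(1)] by (intro sublinear_add) simp
      finally show ?thesis
        using le_funD[OF s(2), of x] le_funD[OF s(3), of y] by linarith
    qed
    then have "(INF q\<in>C. q (x + y)) - r y \<le> (INF q\<in>C. q x)" if "r \<in> C" for r
      using that C(1) by (intro cINF_greatest) (auto simp: algebra_simps)
    then have "(INF q\<in>C. q (x + y)) - (INF q\<in>C. q x) \<le> (INF q\<in>C. q y)"
      using C(1) by (intro cINF_greatest) (auto simp: algebra_simps)
    then show "(INF q\<in>C. q (x + y)) \<le> (INF q\<in>C. q x) + (INF q\<in>C. q y)"
      by simp
  next
    fix c :: real and x
    assume c: "0 \<le> c"
    show "(INF q\<in>C. q (c *\<^sub>R x)) \<le> c * (INF q\<in>C. q x)"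
    proof (cases "c = 0")
      case True
      then have "(INF q\<in>C. q (c *\<^sub>R x)) = (INF q\<in>C. 0)"
        using C(2) by (intro INF_cong) (auto simp: sublinear_zero)
      with True C(1) show ?thesis
        by simp
    next
      case False
      have "(INF q\<in>C. q (c *\<^sub>R x)) / c \<le> q x" if "q \<in> C" for q
        using lower[OF that, of "c *\<^sub>R x"] sublinear_scaleR[of q c x] C(2)[OF that] c False
        by (simp add: field_simps)
      then have "(INF q\<in>C. q (c *\<^sub>R x)) / c \<le> (INF q\<in>C. q x)"
        using C(1) by (intro cINF_greatest)
      with c False show ?thesis
        by (simp add: field_simps)
    qed
  qed
qed

text \<open>
  A minimal sublinear functional \<open>m\<close> is linear: tightening it in any direction cannot lower it, so
  \<open>m (- x) = - m x\<close>, and an odd sublinear functional is additive.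
\<close>

theorem Hahn_Banach_sublinear:
  fixes p :: "'a::real_vector \<Rightarrow> real"
  assumes p: "sublinear p"
  obtains h where "linear h" "h \<le> p"
proof -
  define A where "A = {q. sublinear q \<and> q \<le> p}"
  \<comment> \<open>The order is reversed, so that the maximal elements given by Zorn's lemma are minimal
    functionals.\<close>
  define geq :: "('a \<Rightarrow> real) \<Rightarrow> ('a \<Rightarrow> real) \<Rightarrow> bool" where "geq = (\<lambda>q r. r \<le> q)"
  have "\<exists>m\<in>A. \<forall>q\<in>A. geq m q \<longrightarrow> q = m"
  proof (rule predicate_Zorn)
    show "partial_order_on A (relation_of geq A)"
      by (rule partial_order_on_relation_ofI) (auto simp: geq_def)
  next
    fix C
    assume "C \<in> Chains (relation_of geq A)"
    then have sub: "\<And>q. q \<in> C \<Longrightarrow> q \<in> A"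
      and chain: "\<And>q r. q \<in> C \<Longrightarrow> r \<in> C \<Longrightarrow> q \<le> r \<or> r \<le> q"
      by (auto simp: Chains_def relation_of_def geq_def)
    show "\<exists>u\<in>A. \<forall>q\<in>C. geq q u"
    proof (cases "C = {}")
      case True
      with p show ?thesis
        by (auto simp: A_def)
    next
      case False
      define u where "u = (\<lambda>x. INF q\<in>C. q x)"
      have C: "sublinear q \<and> q \<le> p" if "q \<in> C" for q
        using sub[OF that] by (simp add: A_def)
      have "sublinear u"
        unfolding u_def by (rule sublinear_INF_chain(1)[OF False C chain])
      moreover have le: "u \<le> q" if "q \<in> C" for q
        unfolding u_def using sublinear_INF_chain(2)[OF False C chain that] by (simp add: le_fun_def)
      moreover have "u \<le> p"
      proof -
        obtain q where "q \<in> C"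
          using False by blast
        with le[of q] C[of q] show ?thesis
          by (meson order_trans)
      qed
      ultimately show ?thesis
        by (auto simp: A_def geq_def)
    qed
  qed
  then obtain m where m: "sublinear m" "m \<le> p"
    and minimal: "\<And>q. sublinear q \<Longrightarrow> q \<le> m \<Longrightarrow> q = m"
    unfolding A_def geq_def by (auto intro: order_trans)
  have odd: "m (- x) = - m x" for x
  proof -
    have "tighten m x = m"
      using m(1) by (intro minimal sublinear_tighten) (simp_all add: le_fun_def tighten_self)
    then have "m (- x) \<le> - m x"
      using tighten_minus[OF m(1), of x] by simp
    with sublinear_minus[OF m(1), of x] show ?thesis
      by simp
  qed
  have "linear m"
  proof (rule linearI)
    fix x y
    have "m (- x + - y) \<le> m (- x) + m (- y)"
      using m(1) by (rule sublinear_add)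
    moreover have "- x + - y = - (x + y)"
      by simp
    ultimately show "m (x + y) = m x + m y"
      using sublinear_add[OF m(1), of x y] odd[of x] odd[of y] odd[of "x + y"] by simp
  next
    fix c x
    show "m (c *\<^sub>R x) = c *\<^sub>R m x"
    proof (cases "0 \<le> c")
      case True
      with m(1) show ?thesis
        by (simp add: sublinear_scaleR)
    next
      case False
      then have "m ((- c) *\<^sub>R x) = - c * m x"
        using m(1) by (intro sublinear_scaleR) simp_all
      then show ?thesis
        using odd[of "c *\<^sub>R x"] by simp
    qed
  qed
  with m(2) show ?thesis
    by (rule that[rotated])
qed

text \<open>
  A linear functional below the norm tightened in the direction \<open>z\<close> is at most \<open>- norm z\<close> at \<open>- z\<close>.
\<close>

lemma norming_real_functional:
  fixes z :: "'a::real_normed_vector"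
  obtains h where "bounded_linear h" "\<And>x. h x \<le> norm x" "h z = norm z"
proof -
  obtain h where h: "linear h" "h \<le> tighten norm z"
    using Hahn_Banach_sublinear[OF sublinear_tighten[OF sublinear_norm]] .
  have le: "h x \<le> norm x" for x
    using le_funD[OF h(2), of x] tighten_self[OF sublinear_norm, of z x] by linarith
  have "h (- z) \<le> - norm z"
    using le_funD[OF h(2), of "- z"] tighten_minus[OF sublinear_norm, of z] by linarith
  then have "h z = norm z"
    using le[of z] linear_neg[OF h(1), of z] by linarith
  moreover have "bounded_linear h"
  proof (rule bounded_linear_intro[of h 1])
    fix x
    show "norm (h x) \<le> norm x * 1"
      using le[of x] le[of "- x"] linear_neg[OF h(1), of x] by simp
  qed (use h(1) in \<open>simp_all add: linear_add linear_scale\<close>)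
  ultimately show ?thesis
    using le that by blast
qed

section \<open>Functionals over the scalar field and their real parts\<close>

text \<open>
  What the argument needs to know about the scalars: a real part that does not exceed the norm, and
  that every bounded real-linear functional is the real part of a functional over \<open>'k\<close>.
\<close>

locale banach_space_real_part = banach_space_over scale
  for scale :: "'k::{real_normed_field,banach} \<Rightarrow> 'a::banach \<Rightarrow> 'a" +
  fixes re :: "'k \<Rightarrow> real"
  assumes re_bounded_linear: "bounded_linear re"
    and re_le_norm: "re c \<le> norm c"
    and re_of_real: "re (of_real r) = r"
    and extend_real_functional:
      "bounded_linear h \<Longrightarrow> \<exists>F\<in>bounded_ops scale (*). \<forall>x. re (blinfun_apply F x) = h x"
begin

abbreviation functionals :: "('a \<Rightarrow>\<^sub>L 'k) set"
  where "functionals \<equiv> bounded_ops scale (*)"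

lemma functionals_iff:
  "F \<in> functionals \<longleftrightarrow> (\<forall>c x. blinfun_apply F (scale c x) = c * blinfun_apply F x)"
proof -
  have "vector_space ((*) :: 'k \<Rightarrow> 'k \<Rightarrow> 'k)"
    by unfold_locales (simp_all add: algebra_simps)
  then show ?thesis
    using vector_space_axioms by (simp add: bounded_ops_def Vector_Spaces.linear_iff blinfun.add_right)
qed

definition rotate :: "'k \<Rightarrow> ('a \<Rightarrow>\<^sub>L 'k) \<Rightarrow> ('a \<Rightarrow>\<^sub>L 'k)"
  where "rotate u F = blinfun_mult_right u o\<^sub>L F"

lemma rotate_apply [simp]: "blinfun_apply (rotate u F) x = u * blinfun_apply F x"
  by (simp add: rotate_def)

lemma rotate_in_functionals: "F \<in> functionals \<Longrightarrow> rotate u F \<in> functionals"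
  by (simp add: functionals_iff)

lemma norm_rotate_le: "norm (rotate u F) \<le> norm u * norm F"
proof (rule norm_blinfun_bound)
  fix x
  show "norm (blinfun_apply (rotate u F) x) \<le> norm u * norm F * norm x"
    using norm_blinfun[of F x] by (simp add: norm_mult mult.assoc mult_left_mono)
qed simp

lemma re_le_functional: "re (blinfun_apply F x) \<le> norm F * norm x"
  using re_le_norm norm_blinfun order_trans by blast

text \<open>
  The norm of a functional over \<open>'k\<close> is determined by its real part, because the phase of
  \<open>F x\<close> can be moved into the argument.
\<close>

lemma norm_functional_le:
  assumes F: "F \<in> functionals" and "0 \<le> b"
    and re: "\<And>x. norm x = 1 \<Longrightarrow> re (blinfun_apply F x) \<le> b"
  shows "norm F \<le> b"
proof (rule norm_blinfun_bound)
  fix x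
  show "norm (blinfun_apply F x) \<le> b * norm x"
  proof (cases "blinfun_apply F x = 0")
    case True
    with \<open>0 \<le> b\<close> show ?thesis
      by simp
  next
    case False
    then have x: "x \<noteq> 0"
      by auto
    define c where "c = of_real (norm (blinfun_apply F x)) / blinfun_apply F x / of_real (norm x)"
    have "norm c = inverse (norm x)"
      using False by (simp add: c_def norm_divide norm_mult inverse_eq_divide)
    then have "norm (scale c x) = 1"
      using x by (simp add: norm_scale)
    then have "re (c * blinfun_apply F x) \<le> b"
      using re[of "scale c x"] F by (simp add: functionals_iff)
    moreover have "c * blinfun_apply F x = of_real (norm (blinfun_apply F x) / norm x)"
      using False by (simp add: c_def)
    ultimately have "norm (blinfun_apply F x) / norm x \<le> b"
      by (simp only: re_of_real)
    then show ?thesis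
      using x by (simp add: field_simps)
  qed
qed fact

lemma norm_eq_1_if_norming:
  assumes "norm F \<le> 1" "norm x = 1" "norm (blinfun_apply F x) = 1"
  shows "norm F = 1"
  using assms norm_blinfun[of F x] by simp

text \<open>
  The extension of a real norming functional has norm at most one, and its value at \<open>z\<close> has real part
  one; dividing by that unimodular value gives the functional.
\<close>

lemma support_functional:
  assumes "norm z = 1"
  obtains F where "F \<in> functionals" "norm F = 1" "blinfun_apply F z = 1"
proof -
  obtain h where h: "bounded_linear h" "\<And>x. h x \<le> norm x" "h z = norm z"
    using norming_real_functional by blast
  obtain F where F: "F \<in> functionals" "\<And>x. re (blinfun_apply F x) = h x"
    using extend_real_functional[OF h(1)] by blast
  have "norm F \<le> 1"
    using h(2) F by (intro norm_functional_le) (auto simp: F(2), metis)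
  moreover have "1 \<le> norm (blinfun_apply F z)"
    using re_le_norm[of "blinfun_apply F z"] F(2)[of z] h(3) assms by simp
  ultimately have Fz: "norm (blinfun_apply F z) = 1"
    using norm_blinfun[of F z] assms by simp
  define G where "G = rotate (inverse (blinfun_apply F z)) F"
  have Gz: "blinfun_apply G z = 1"
    using Fz by (cases "blinfun_apply F z = 0") (simp_all add: G_def)
  have "norm G \<le> 1"
    using norm_rotate_le[of "inverse (blinfun_apply F z)" F] Fz \<open>norm F \<le> 1\<close>
    by (simp add: G_def norm_inverse)
  with Gz assms have "norm G = 1"
    using norm_eq_1_if_norming[of G z] by simp
  with Gz F(1) show ?thesis
    by (intro that[of G]) (auto simp: G_def rotate_in_functionals)
qed

section \<open>Uniform smoothness yields the point property\<close>

text \<open>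
  The quotients at \<open>t\<close> and \<open>- t\<close> are both near the derivative \<open>D (z, y)\<close>, so it cancels when they are
  subtracted.
\<close>

lemma uniformly_smooth_second_difference:
  assumes "uniformly_smooth TYPE('a)" "0 < e"
  obtains t where "0 < t"
    "\<And>z y :: 'a. norm z = 1 \<Longrightarrow> norm y \<le> 1 \<Longrightarrow>
      norm (z + t *\<^sub>R y) + norm (z - t *\<^sub>R y) - 2 < e * t"
proof -
  obtain D where D: "uniform_limit (sphere (0::'a) 1 \<times> cball (0::'a) 1)
           (\<lambda>t (z, x). (norm (z + t *\<^sub>R x) - 1) / t) D (at (0::real))"
    using assms(1) unfolding uniformly_smooth_def by blast
  have "\<forall>\<^sub>F t in at 0. \<forall>zy\<in>sphere (0::'a) 1 \<times> cball 0 1.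
      dist (case zy of (z, y) \<Rightarrow> (norm (z + t *\<^sub>R y) - 1) / t) (D zy) < e / 2"
    using uniform_limitD[OF D, of "e / 2"] \<open>0 < e\<close> by simp
  then obtain d where d: "0 < d"
    "\<And>t z y. t \<noteq> 0 \<Longrightarrow> \<bar>t\<bar> < d \<Longrightarrow> norm (z::'a) = 1 \<Longrightarrow> norm y \<le> 1 \<Longrightarrow>
      \<bar>(norm (z + t *\<^sub>R y) - 1) / t - D (z, y)\<bar> < e / 2"
    unfolding eventually_at by (fastforce simp: dist_real_def)
  define t where "t = d / 2"
  have t: "0 < t" "t < d"
    using d(1) by (auto simp: t_def)
  show ?thesis
  proof (rule that[OF t(1)])
    fix z y :: 'a
    assume zy: "norm z = 1" "norm y \<le> 1"
    have "\<bar>(norm (z + t *\<^sub>R y) - 1) / t - D (z, y)\<bar> < e / 2"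
      using d(2)[of t z y] t zy by simp
    moreover have "\<bar>(norm (z + (- t) *\<^sub>R y) - 1) / (- t) - D (z, y)\<bar> < e / 2"
      using d(2)[of "- t" z y] t zy by simp
    ultimately have "(norm (z + t *\<^sub>R y) - 1) / t - (norm (z + (- t) *\<^sub>R y) - 1) / (- t) < e"
      by linarith
    then have "(norm (z + t *\<^sub>R y) + norm (z - t *\<^sub>R y) - 2) / t < e"
      by (simp add: add_divide_distrib diff_divide_distrib)
    then show "norm (z + t *\<^sub>R y) + norm (z - t *\<^sub>R y) - 2 < e * t"
      using t(1) by (simp add: field_simps)
  qed
qed

text \<open>
  Evaluating \<open>G\<close> at \<open>x + t y\<close> and \<open>F\<close> at \<open>x - t y\<close> turns the bound on the second difference of the norm
  into a bound on \<open>t\<close> times the real part of \<open>(G - F) y\<close>.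
\<close>

lemma norm_diff_functionals_le:
  assumes t: "0 < t" and x: "norm x = 1"
    and diff: "\<And>y. norm y \<le> 1 \<Longrightarrow> norm (x + t *\<^sub>R y) + norm (x - t *\<^sub>R y) - 2 < e * t"
    and F: "F \<in> functionals" "norm F \<le> 1" "1 - e * t < re (blinfun_apply F x)"
    and G: "G \<in> functionals" "norm G \<le> 1" "re (blinfun_apply G x) = 1"
  shows "norm (G - F) \<le> 2 * e"
proof (rule norm_functional_le)
  show "G - F \<in> functionals"
    using F(1) G(1) by (simp add: functionals_iff blinfun.diff_left algebra_simps)
  have "norm x \<le> (norm (x + t *\<^sub>R 0) + norm (x - t *\<^sub>R 0)) / 2"
    by simp
  then have "0 < e * t"
    using diff[of 0] x by simp
  then show "0 \<le> 2 * e"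
    using t by (simp add: zero_less_mult_iff)
  fix y :: 'a
  assume "norm y = 1"
  have le: "re (blinfun_apply H v) \<le> norm v" if "norm H \<le> 1" for H v
    using re_le_functional[of H v] that mult_right_mono[OF that, of "norm v"] by simp
  have "re (blinfun_apply G (x + t *\<^sub>R y)) + re (blinfun_apply F (x - t *\<^sub>R y)) < 2 + e * t"
    using le[OF G(2), of "x + t *\<^sub>R y"] le[OF F(2), of "x - t *\<^sub>R y"] diff[of y] \<open>norm y = 1\<close>
    by linarith
  then have "t * re (blinfun_apply (G - F) y) < 2 * e * t"
    using F(3) G(3) re_bounded_linear
    by (simp add: blinfun.bilinear_simps linear_simps algebra_simps)
  then show "re (blinfun_apply (G - F) y) \<le> 2 * e"
    using t by (simp add: mult.commute)
qed

lemma BPBpp_if_uniformly_smooth: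
  assumes smooth: "uniformly_smooth TYPE('a)"
  shows "BPBpp scale ((*) :: 'k \<Rightarrow> 'k \<Rightarrow> 'k)"
  unfolding BPBpp_def
proof (intro allI impI)
  fix \<epsilon> :: real
  assume "0 < \<epsilon>"
  then obtain t where t: "0 < t"
    "\<And>z y :: 'a. norm z = 1 \<Longrightarrow> norm y \<le> 1 \<Longrightarrow>
      norm (z + t *\<^sub>R y) + norm (z - t *\<^sub>R y) - 2 < \<epsilon> / 3 * t"
    using uniformly_smooth_second_difference[OF smooth, of "\<epsilon> / 3"] by auto
  show "\<exists>\<eta>>0. \<forall>T\<in>functionals. \<forall>x\<in>sphere 0 1.
       norm T = 1 \<longrightarrow> norm (blinfun_apply T x) > 1 - \<eta> \<longrightarrow>
       (\<exists>S\<in>functionals. norm S = 1 \<and> norm (blinfun_apply S x) = 1 \<and> norm (S - T) < \<epsilon>)"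
    \<comment> \<open>The bound \<open>1\<close> keeps \<open>T x\<close> away from \<open>0\<close>, so that its phase is defined.\<close>
  proof (intro exI[of _ "min 1 (\<epsilon> / 3 * t)"] conjI ballI impI)
    show "0 < min 1 (\<epsilon> / 3 * t)"
      using t(1) \<open>0 < \<epsilon>\<close> by simp
    fix T x
    assume T: "T \<in> functionals" "norm T = 1"
      and x: "x \<in> sphere 0 1"
      and Tx: "1 - min 1 (\<epsilon> / 3 * t) < norm (blinfun_apply T x)"
    have x1: "norm x = 1"
      using x by simp
    have Tx0: "blinfun_apply T x \<noteq> 0"
      using Tx by auto
    define u where "u = blinfun_apply T x / of_real (norm (blinfun_apply T x))"
    have u: "norm u = 1" "u \<noteq> 0"
      using Tx0 by (auto simp: u_def norm_divide)
    define F where "F = rotate (inverse u) T"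
    obtain G where G: "G \<in> functionals" "norm G = 1" "blinfun_apply G x = 1"
      using support_functional[OF x1] .
    have Fx: "blinfun_apply F x = of_real (norm (blinfun_apply T x))"
      using Tx0 by (simp add: F_def u_def)
    have "norm (G - F) \<le> 2 * (\<epsilon> / 3)"
    proof (rule norm_diff_functionals_le[OF t(1) x1])
      show "norm (x + t *\<^sub>R y) + norm (x - t *\<^sub>R y) - 2 < \<epsilon> / 3 * t" if "norm y \<le> 1" for y
        using t(2)[OF x1 that] .
      show "F \<in> functionals"
        using T(1) by (simp add: F_def rotate_in_functionals)
      show "norm F \<le> 1"
        using norm_rotate_le[of "inverse u" T] T(2) u(1) by (simp add: F_def norm_inverse)
      show "1 - \<epsilon> / 3 * t < re (blinfun_apply F x)"
        using Tx by (simp add: Fx re_of_real)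
      show "re (blinfun_apply G x) = 1"
        using re_of_real[of 1] by (simp add: G(3))
    qed (use G in auto)
    define S where "S = rotate u G"
    have Sx: "norm (blinfun_apply S x) = 1"
      using G(3) u(1) by (simp add: S_def)
    have "norm S \<le> 1"
      using norm_rotate_le[of u G] G(2) u(1) by (simp add: S_def)
    with Sx x1 have "norm S = 1"
      by (intro norm_eq_1_if_norming)
    moreover have "S - T = rotate u (G - F)"
      using u(2) by (intro blinfun_eqI) (simp add: S_def F_def blinfun.diff_left algebra_simps)
    then have "norm (S - T) \<le> norm (G - F)"
      using norm_rotate_le[of u "G - F"] u(1) by simp
    then have "norm (S - T) < \<epsilon>"
      using \<open>norm (G - F) \<le> 2 * (\<epsilon> / 3)\<close> \<open>0 < \<epsilon>\<close> by simp
    moreover have "S \<in> functionals"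
      using G(1) by (simp add: S_def rotate_in_functionals)
    ultimately show "\<exists>S\<in>functionals. norm S = 1 \<and> norm (blinfun_apply S x) = 1 \<and> norm (S - T) < \<epsilon>"
      using Sx by blast
  qed
qed

section \<open>The point property yields uniform smoothness\<close>

text \<open>
  Since \<open>f\<close> supports the ball at \<open>z\<close>, and \<open>S\<close> supports it in the direction of \<open>z + t x\<close>,
  the increment \<open>norm (z + t x) - 1\<close> lies between \<open>t Re f x\<close> and \<open>t Re S x\<close>. For negative \<open>t\<close> the two
  bounds on the quotient change places.
\<close>

lemma difference_quotient_close:
  assumes z: "norm z = 1" and x: "norm x \<le> 1" and "t \<noteq> 0"
    and f: "norm f \<le> 1" "re (blinfun_apply f z) = 1"
    and S: "norm S \<le> 1" "re (blinfun_apply S (z + t *\<^sub>R x)) = norm (z + t *\<^sub>R x)"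
  shows "\<bar>(norm (z + t *\<^sub>R x) - 1) / t - re (blinfun_apply f x)\<bar> \<le> norm (S - f)"
proof -
  have le: "re (blinfun_apply H v) \<le> norm v" if "norm H \<le> 1" for H v
    using re_le_functional[of H v] that mult_right_mono[OF that, of "norm v"] by simp
  have "1 + t * re (blinfun_apply f x) \<le> norm (z + t *\<^sub>R x)"
    using le[OF f(1), of "z + t *\<^sub>R x"] f(2) re_bounded_linear
    by (simp add: blinfun.bilinear_simps linear_simps)
  moreover have "norm (z + t *\<^sub>R x) \<le> 1 + t * re (blinfun_apply S x)"
    using le[OF S(1), of z] S(2) z re_bounded_linear
    by (simp add: blinfun.bilinear_simps linear_simps)
  ultimately have quotient_between:
    "0 < t \<and> re (blinfun_apply f x) \<le> (norm (z + t *\<^sub>R x) - 1) / t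
        \<and> (norm (z + t *\<^sub>R x) - 1) / t \<le> re (blinfun_apply S x)
      \<or> t < 0 \<and> re (blinfun_apply S x) \<le> (norm (z + t *\<^sub>R x) - 1) / t
        \<and> (norm (z + t *\<^sub>R x) - 1) / t \<le> re (blinfun_apply f x)"
    using \<open>t \<noteq> 0\<close> by (cases "0 < t") (auto simp: field_simps)
  have "\<bar>(norm (z + t *\<^sub>R x) - 1) / t - re (blinfun_apply f x)\<bar>
      \<le> \<bar>re (blinfun_apply S x) - re (blinfun_apply f x)\<bar>"
    using quotient_between by linarith
  also have "\<dots> = \<bar>re (blinfun_apply (S - f) x)\<bar>"
    using re_bounded_linear by (simp add: blinfun.diff_left linear_simps)
  also have "\<dots> \<le> norm (S - f) * norm x"
    using re_le_functional[of "S - f" x] re_le_functional[of "S - f" "- x"] re_bounded_linear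
    by (simp add: blinfun.minus_right linear_simps)
  also have "\<dots> \<le> norm (S - f)"
    using x by (simp add: mult_left_le)
  finally show ?thesis .
qed

lemma uniformly_smooth_if_BPBpp:
  assumes BPB: "BPBpp scale ((*) :: 'k \<Rightarrow> 'k \<Rightarrow> 'k)"
  shows "uniformly_smooth TYPE('a)"
proof -
  define supp where
    "supp z = (SOME F. F \<in> functionals \<and> norm F = 1 \<and> blinfun_apply F z = 1)" for z
  have supp: "supp z \<in> functionals" "norm (supp z) = 1" "blinfun_apply (supp z) z = 1"
    if "norm z = 1" for z
  proof -
    have "\<exists>F. F \<in> functionals \<and> norm F = 1 \<and> blinfun_apply F z = 1"
      using support_functional[OF that] by metis
    from someI_ex[OF this] show "supp z \<in> functionals" "norm (supp z) = 1"
      "blinfun_apply (supp z) z = 1"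
      by (auto simp: supp_def)
  qed
  define D where "D = (\<lambda>(z, x). re (blinfun_apply (supp z) x))"
  have "uniform_limit (sphere (0::'a) 1 \<times> cball (0::'a) 1)
           (\<lambda>t (z, x). (norm (z + t *\<^sub>R x) - 1) / t) D (at (0::real))"
  proof (rule uniform_limitI)
    fix \<epsilon> :: real
    assume \<epsilon>: "0 < \<epsilon>"
    then obtain \<eta> where \<eta>: "0 < \<eta>"
      "\<And>T x. T \<in> functionals \<Longrightarrow> norm x = 1 \<Longrightarrow> norm T = 1 \<Longrightarrow> norm (blinfun_apply T x) > 1 - \<eta> \<Longrightarrow>
       \<exists>S\<in>functionals. norm S = 1 \<and> norm (blinfun_apply S x) = 1 \<and> norm (S - T) < \<epsilon> / 4"
      using BPB[unfolded BPBpp_def, rule_format, of "\<epsilon> / 4"] by auto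
    \<comment> \<open>The three bounds on \<open>t\<close> keep \<open>norm (z + t x)\<close> above \<open>1 / 2\<close>, make \<open>f\<close> norm \<open>w\<close> up to \<open>\<eta>\<close>, and
      leave room for \<open>4 t\<close> in the error of the rotation.\<close>
    define d where "d = min (1 / 2) (min (\<eta> / 4) (\<epsilon> / 16))"
    have "0 < d"
      using \<eta>(1) \<epsilon> by (simp add: d_def)
    moreover have "\<bar>(norm (z + t *\<^sub>R x) - 1) / t - re (blinfun_apply (supp z) x)\<bar> < \<epsilon>"
      if t: "t \<noteq> 0" "\<bar>t\<bar> < d" and z: "norm z = 1" and x: "norm x \<le> 1" for t and z x :: 'a
    proof -
      have td: "\<bar>t\<bar> < 1 / 2" "4 * \<bar>t\<bar> < \<eta>" "4 * \<bar>t\<bar> < \<epsilon> / 4"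
        using t(2) by (auto simp: d_def)
      define f where "f = supp z"
      note f = supp[OF z, folded f_def]
      define N where "N = norm (z + t *\<^sub>R x)"
      have tx: "norm (t *\<^sub>R x) \<le> \<bar>t\<bar>"
        using x by (simp add: mult_left_le)
      have N1: "\<bar>N - 1\<bar> \<le> \<bar>t\<bar>"
        using norm_triangle_ineq3[of "z + t *\<^sub>R x" z] tx z by (simp add: N_def)
      then have N: "1 / 2 < N"
        using td(1) by linarith
      define w where "w = (1 / N) *\<^sub>R (z + t *\<^sub>R x)"
      have w: "norm w = 1"
        using N by (auto simp: w_def N_def)
      have zw: "z + t *\<^sub>R x = N *\<^sub>R w"
        using N by (simp add: w_def)
      have fw: "norm (blinfun_apply f w - 1) \<le> 4 * \<bar>t\<bar>"
      proof -
        have "norm (z - w) = norm ((1 / N) *\<^sub>R ((N - 1) *\<^sub>R z - t *\<^sub>R x))"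
          using N by (simp add: w_def algebra_simps)
        also have "\<dots> \<le> (1 / N) * (\<bar>N - 1\<bar> + \<bar>t\<bar>)"
          using norm_triangle_ineq4[of "(N - 1) *\<^sub>R z" "t *\<^sub>R x"] tx z N
          by (simp add: divide_right_mono)
        also have "\<dots> \<le> 2 * (\<bar>t\<bar> + \<bar>t\<bar>)"
          using N N1 by (intro mult_mono) (auto simp: field_simps)
        finally have "norm (w - z) \<le> 4 * \<bar>t\<bar>"
          by (simp add: norm_minus_commute)
        then show ?thesis
          using norm_blinfun[of f "w - z"] f by (simp add: blinfun.diff_right)
      qed
      have "1 - 4 * \<bar>t\<bar> \<le> norm (blinfun_apply f w)"
        using fw norm_triangle_ineq3[of "blinfun_apply f w" 1] by simp
      then have "1 - \<eta> < norm (blinfun_apply f w)"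
        using td(2) by linarith
      then obtain S where S: "S \<in> functionals" "norm S = 1" "norm (blinfun_apply S w) = 1"
        "norm (S - f) < \<epsilon> / 4"
        using \<eta>(2)[OF f(1) w f(2)] by blast
      define c where "c = inverse (blinfun_apply S w)"
      have c: "norm c = 1" "c * blinfun_apply S w = 1"
        using S(3) by (cases "blinfun_apply S w = 0"; simp add: c_def norm_inverse)+
      have "norm (blinfun_apply S w - blinfun_apply f w) < \<epsilon> / 4"
        using norm_blinfun[of "S - f" w] w S(4) by (simp add: blinfun.diff_left)
      then have Sw: "norm (blinfun_apply S w - 1) < \<epsilon> / 4 + 4 * \<bar>t\<bar>"
        using fw norm_triangle_ineq[of "blinfun_apply S w - blinfun_apply f w"
            "blinfun_apply f w - 1"] by simp
      have "c - 1 = - (c * (blinfun_apply S w - 1))"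
        using c(2) by (simp add: algebra_simps)
      then have c1: "norm (c - 1) < \<epsilon> / 4 + 4 * \<bar>t\<bar>"
        using Sw c(1) by (simp add: norm_mult)
      define S' where "S' = rotate c S"
      have "S' - S = rotate (c - 1) S"
        by (intro blinfun_eqI) (simp add: S'_def blinfun.diff_left algebra_simps)
      then have "norm (S' - S) < \<epsilon> / 4 + 4 * \<bar>t\<bar>"
        using norm_rotate_le[of "c - 1" S] S(2) c1 by simp
      then have S'f: "norm (S' - f) < \<epsilon>"
        using norm_triangle_ineq[of "S' - S" "S - f"] S(4) td(3) by simp
      have "norm S' \<le> 1"
        using norm_rotate_le[of c S] c(1) S(2) by (simp add: S'_def)
      moreover have "re (blinfun_apply S' (z + t *\<^sub>R x)) = norm (z + t *\<^sub>R x)"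
      proof -
        have "blinfun_apply S' (z + t *\<^sub>R x) = of_real N"
          using c(2) by (simp add: zw S'_def blinfun.scaleR_right scaleR_conv_of_real)
        then show ?thesis
          by (simp add: re_of_real N_def)
      qed
      moreover have "re (blinfun_apply f z) = 1"
        using re_of_real[of 1] f(3) by simp
      ultimately have "\<bar>(norm (z + t *\<^sub>R x) - 1) / t - re (blinfun_apply f x)\<bar> \<le> norm (S' - f)"
        using f(2) by (intro difference_quotient_close z x t(1)) simp_all
      with S'f show ?thesis
        by (simp add: f_def)
    qed
    ultimately show "\<forall>\<^sub>F t in at 0. \<forall>zx\<in>sphere (0::'a) 1 \<times> cball 0 1.
        dist (case zx of (z, x) \<Rightarrow> (norm (z + t *\<^sub>R x) - 1) / t) (D zx) < \<epsilon>"
      unfolding eventually_at by (intro exI[of _ d]) (auto simp: dist_real_def D_def)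
  qed
  then show ?thesis
    unfolding uniformly_smooth_def by blast
qed

theorem uniformly_smooth_iff_BPBpp:
  "uniformly_smooth TYPE('a) \<longleftrightarrow> BPBpp scale ((*) :: 'k \<Rightarrow> 'k \<Rightarrow> 'k)"
  using BPBpp_if_uniformly_smooth uniformly_smooth_if_BPBpp by blast

end

section \<open>Real and complex scalars\<close>

lemma banach_space_real_part_real:
  "banach_space_real_part (scaleR :: real \<Rightarrow> 'a::banach \<Rightarrow> 'a) (\<lambda>c. c)"
proof -
  interpret banach_space_over "scaleR :: real \<Rightarrow> 'a \<Rightarrow> 'a"
    by (rule banach_space_over_scaleR)
  show ?thesis
  proof (intro banach_space_real_part.intro banach_space_real_part_axioms.intro
      banach_space_over_axioms)
    show "bounded_linear (\<lambda>c::real. c)"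
      by (rule bounded_linear_ident)
    fix h :: "'a \<Rightarrow> real"
    assume h: "bounded_linear h"
    have "Blinfun h \<in> bounded_ops scaleR (*)"
      using h vector_space_axioms
      by (simp add: bounded_ops_def Vector_Spaces.linear_iff bounded_linear_Blinfun_apply
          real_vector.vector_space_axioms linear_simps) (unfold_locales, auto simp: algebra_simps)
    then show "\<exists>F\<in>bounded_ops scaleR (*). \<forall>x. blinfun_apply F x = h x"
      using h by (intro bexI[of _ "Blinfun h"]) (simp_all add: bounded_linear_Blinfun_apply)
  qed simp_all
qed

text \<open>
  A real functional \<open>h\<close> is the real part of the complex functional \<open>h x - \<i> h (\<i> x)\<close>.
\<close>

lemma banach_space_real_part_complex:
  fixes scaleC :: "complex \<Rightarrow> 'b::banach \<Rightarrow> 'b"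
  assumes "banach_space_over scaleC"
  shows "banach_space_real_part scaleC Re"
proof -
  interpret banach_space_over scaleC
    by fact
  show ?thesis
  proof (intro banach_space_real_part.intro banach_space_real_part_axioms.intro
      banach_space_over_axioms)
    show "bounded_linear Re"
      by (rule bounded_linear_Re)
    show "Re c \<le> norm c" for c
      by (rule complex_Re_le_cmod)
    fix h :: "'b \<Rightarrow> real"
    assume h: "bounded_linear h"
    have scaleR_scale: "r *\<^sub>R x = scaleC (of_real r) x" for r x
      by (simp add: scale_of_real)
    have i: "bounded_linear (scaleC \<i>)"
      by (rule bounded_linear_intro[of _ 1])
        (simp_all add: scale_right_distrib norm_scale scaleR_scale mult.commute)
    define F where "F x = of_real (h x) - \<i> * of_real (h (scaleC \<i> x))" for x
    have bl: "bounded_linear F"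
      unfolding F_def
      by (intro bounded_linear_sub bounded_linear_const_mult
          bounded_linear_compose[OF bounded_linear_of_real] bounded_linear_compose[OF h] i h)
    have scale_cases: "scaleC c x = Re c *\<^sub>R x + Im c *\<^sub>R scaleC \<i> x" for c x
    proof -
      have "scaleC c x = scaleC (of_real (Re c) + of_real (Im c) * \<i>) x"
        by (simp add: complex_eq mult.commute)
      then show ?thesis
        by (simp only: scale_left_distrib scale_of_real flip: scale_scale)
    qed
    have "F (scaleC c x) = c * F x" for c x
    proof -
      have "h (scaleC c x) = Re c * h x + Im c * h (scaleC \<i> x)"
        using h by (simp add: scale_cases[of c] linear_simps)
      moreover have "h (scaleC \<i> (scaleC c x)) = Re c * h (scaleC \<i> x) - Im c * h x"
        using h by (simp add: scale_cases[of "\<i> * c"] linear_simps)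
      ultimately show ?thesis
        by (simp add: F_def complex_eq_iff algebra_simps)
    qed
    moreover have "vector_space ((*) :: complex \<Rightarrow> complex \<Rightarrow> complex)"
      by unfold_locales (simp_all add: algebra_simps)
    ultimately have "Blinfun F \<in> bounded_ops scaleC (*)"
      using bl vector_space_axioms
      by (simp add: bounded_ops_def Vector_Spaces.linear_iff bounded_linear_Blinfun_apply linear_simps)
    moreover have "Re (F x) = h x" for x
      by (simp add: F_def)
    ultimately show "\<exists>F\<in>bounded_ops scaleC (*). \<forall>x. Re (blinfun_apply F x) = h x"
      using bl by (intro bexI[of _ "Blinfun F"]) (simp_all add: bounded_linear_Blinfun_apply)
  qed simp_all
qed

theorem proposition2p1:
  shows "(uniformly_smooth TYPE('a::banach) \<longleftrightarrow>
            BPBpp (scaleR :: real \<Rightarrow> 'a \<Rightarrow> 'a) ((*) :: real \<Rightarrow> real \<Rightarrow> real)) \<and>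
         (\<forall>scaleC :: complex \<Rightarrow> 'b::banach \<Rightarrow> 'b. banach_space_over scaleC \<longrightarrow>
            (uniformly_smooth TYPE('b) \<longleftrightarrow>
               BPBpp scaleC ((*) :: complex \<Rightarrow> complex \<Rightarrow> complex)))"
  using banach_space_real_part.uniformly_smooth_iff_BPBpp[OF banach_space_real_part_real]
    banach_space_real_part.uniformly_smooth_iff_BPBpp[OF banach_space_real_part_complex]
  by blast

end
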